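(* Suppose $\mathbf n$ has $l$-bounded quotient gaps, and the basis $\mathcal B$ of $\mathbb X$ is $\mathbf C_{ql}$-$\mathbf n$-quasi-greedy for largest coefficients. Then $\mathcal B$ is $\mathbf C$-quasi-greedy for largest coefficients with $$\mathbf C\le\max\{(n_1-1)\alpha_1\alpha_2,\ l\,\mathbf C_{ql}\}.$$
   Context: $\mathbb X$ is a separable infinite-dimensional Banach space over $\mathbb F=\mathbb R$ or $\mathbb C$, with dual $\mathbb X^*$. A basis of $\mathbb X$ is a sequence $\mathcal B=(\mathbf e_i)_{i\in\mathbb N}\subset\mathbb X$ with closed linear span $\mathbb X$, having a (unique) sequence of biorthogonal functionals $(\mathbf e_i^* )_{i\in\mathbb N}\subset\mathbb X^*$ ($\mathbf e_k^*(\mathbf e_i)=\delta_{k,i}$), with $0<\inf_i\min\{\|\mathbf e_i\|,\|\mathbf e_i^*\|\}\le\sup_i\max\{\|\mathbf e_i\|,\|\mathbf e_i^*\|\}<\infty$. Put $\alpha_1=\sup_i\|\mathbf e_i\|$, $\alpha_2=\sup_i\|\mathbf e_i^*\|$, and $\operatorname{supp}(x)=\{i:\mathbf e_i^*(x)\ne0\}$. $\mathbf n=(n_k)_{k\in\mathbb N}$ is a strictly increasing sequence of positive integers, also regarded as a subset of $\mathbb N$ ($\mathbf n=\mathbb N$ is allowed). For an integer $l\ge2$, $\mathbf n$ has $l$-bounded quotient gaps if $n_{k+1}/n_k\le l$ for all $k$. For a finite $A\subset\mathbb N$, $\Psi_A$ is the set of families $\varepsilon=(\varepsilon_n)_{n\in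 A}\subset\mathbb F$ with $|\varepsilon_n|=1$, and $\mathbf 1_{\varepsilon A}=\sum_{n\in A}\varepsilon_n\mathbf e_n$. $\mathcal B$ is $\mathbf n$-quasi-greedy for largest coefficients if there is $\mathbf C>0$ with $\|\mathbf 1_{\varepsilon A}\|\le\mathbf C\|\mathbf 1_{\varepsilon A}+x\|$ for every $A\subset\mathbb N$ with $|A|\in\mathbf n$, every $\varepsilon\in\Psi_A$, and every $x\in\mathbb X$ with $\operatorname{supp}(x)\cap A=\emptyset$ and $|\mathbf e_i^*(x)|\le1$ for all $i\in\mathbb N$. It is $\mathbf C_{ql}$-$\mathbf n$-quasi-greedy for largest coefficients if $\mathbf C_{ql}$ is the smallest such constant. The prefix $\mathbf n$ is omitted when $\mathbf n=\mathbb N$. *)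

theory Defs
  imports "HOL-Analysis.Analysis"
begin

(* The scalar field is a type of class real_normed_field. Up to isometric isomorphism the
   real and the complex numbers are the only such fields (Gelfand-Mazur), so this is exactly
   "F = R or C". The class banach supplies the norm and the real structure; the F-structure is
   the explicit multiplication scaleF, which has to extend the real one. *)
locale sep_inf_dim_banach_space = vector_space scaleF
  for scaleF :: "'f::real_normed_field \<Rightarrow> 'x::banach \<Rightarrow> 'x" (infixr \<open>*\<^sub>F\<close> 75) +
  assumes scale_of_real: "of_real r *\<^sub>F x = r *\<^sub>R x"
    and norm_scale: "norm (c *\<^sub>F x) = norm c * norm x"
    and separable: "separable_space (euclidean :: 'x topology)"
    and infinite_dimensional: "\<nexists>B. finite B \<and> span B = UNIV"

(* The space of F-linear continuous functionals; the norm of such a functional is its onorm. *)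
definition dual_space :: "('f::real_normed_field \<Rightarrow> 'x::banach \<Rightarrow> 'x) \<Rightarrow> ('x \<Rightarrow> 'f) set" where
  "dual_space scaleF = {f. bounded_linear f \<and> (\<forall>c x. f (scaleF c x) = c * f x)}"

(* e' is the sequence of biorthogonal functionals, which is determined by e.
   The index set {1, 2, ...} of the basis is replaced by the type nat. *)
locale banach_basis = sep_inf_dim_banach_space scaleF
  for scaleF :: "'f::real_normed_field \<Rightarrow> 'x::banach \<Rightarrow> 'x" (infixr \<open>*\<^sub>F\<close> 75) +
  fixes e :: "nat \<Rightarrow> 'x" and e' :: "nat \<Rightarrow> 'x \<Rightarrow> 'f"
  assumes closure_span: "closure (span (range e)) = UNIV"
    and dual: "e' k \<in> dual_space scaleF"
    and biorthogonal: "e' k (e i) = (if k = i then 1 else 0)"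
    and inf_pos: "0 < (INF i. min (norm (e i)) (onorm (e' i)))"
    and sup_finite: "bdd_above (range (\<lambda>i. max (norm (e i)) (onorm (e' i))))"

definition alpha1 :: "(nat \<Rightarrow> 'x::real_normed_vector) \<Rightarrow> real" where
  "alpha1 e = (SUP i. norm (e i))"

definition alpha2 :: "(nat \<Rightarrow> 'x::real_normed_vector \<Rightarrow> 'f::real_normed_field) \<Rightarrow> real" where
  "alpha2 e' = (SUP i. onorm (e' i))"

definition supp :: "(nat \<Rightarrow> 'x \<Rightarrow> 'f::zero) \<Rightarrow> 'x \<Rightarrow> nat set" where
  "supp e' x = {i. e' i x \<noteq> 0}"

(* Only the values of a sign family on A matter. *)
definition signs :: "nat set \<Rightarrow> (nat \<Rightarrow> 'f::real_normed_field) set" where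
  "signs A = {\<epsilon>. \<forall>i\<in>A. norm (\<epsilon> i) = 1}"

definition one_vec ::
  "('f \<Rightarrow> 'x \<Rightarrow> 'x::comm_monoid_add) \<Rightarrow> (nat \<Rightarrow> 'x) \<Rightarrow> (nat \<Rightarrow> 'f) \<Rightarrow> nat set \<Rightarrow> 'x" where
  "one_vec scaleF e \<epsilon> A = (\<Sum>i\<in>A. scaleF (\<epsilon> i) (e i))"

(* A sequence of positive integers n_1 < n_2 < ... is a function on nat: n_(k+1) is n k, so
   that n_1 is n 0. The sequence of all positive integers is Suc. *)
definition pos_int_seq :: "(nat \<Rightarrow> nat) \<Rightarrow> bool" where
  "pos_int_seq n \<longleftrightarrow> strict_mono n \<and> (\<forall>k. 0 < n k)"

definition bounded_quotient_gaps :: "nat \<Rightarrow> (nat \<Rightarrow> nat) \<Rightarrow> bool" where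
  "bounded_quotient_gaps l n \<longleftrightarrow> (\<forall>k. real (n (Suc k)) / real (n k) \<le> real l)"

definition qglc_bound :: "('f::real_normed_field \<Rightarrow> 'x::banach \<Rightarrow> 'x) \<Rightarrow> (nat \<Rightarrow> 'x) \<Rightarrow>
    (nat \<Rightarrow> 'x \<Rightarrow> 'f) \<Rightarrow> (nat \<Rightarrow> nat) \<Rightarrow> real \<Rightarrow> bool" where
  "qglc_bound scaleF e e' n C \<longleftrightarrow> C > 0 \<and>
    (\<forall>A \<epsilon> x. finite A \<longrightarrow> card A \<in> range n \<longrightarrow> \<epsilon> \<in> signs A \<longrightarrow>
       supp e' x \<inter> A = {} \<longrightarrow> (\<forall>i. norm (e' i x) \<le> 1) \<longrightarrow>
       norm (one_vec scaleF e \<epsilon> A) \<le> C * norm (one_vec scaleF e \<epsilon> A + x))"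

(* "C-n-quasi-greedy for largest coefficients": C is the smallest admissible constant. *)
definition n_quasi_greedy_largest_coeffs :: "('f::real_normed_field \<Rightarrow> 'x::banach \<Rightarrow> 'x) \<Rightarrow>
    (nat \<Rightarrow> 'x) \<Rightarrow> (nat \<Rightarrow> 'x \<Rightarrow> 'f) \<Rightarrow> (nat \<Rightarrow> nat) \<Rightarrow> real \<Rightarrow> bool" where
  "n_quasi_greedy_largest_coeffs scaleF e e' n C \<longleftrightarrow>
    qglc_bound scaleF e e' n C \<and> (\<forall>C'. qglc_bound scaleF e e' n C' \<longrightarrow> C \<le> C')"

definition quasi_greedy_largest_coeffs :: "('f::real_normed_field \<Rightarrow> 'x::banach \<Rightarrow> 'x) \<Rightarrow>
    (nat \<Rightarrow> 'x) \<Rightarrow> (nat \<Rightarrow> 'x \<Rightarrow> 'f) \<Rightarrow> real \<Rightarrow> bool" where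
  "quasi_greedy_largest_coeffs scaleF e e' C \<longleftrightarrow> n_quasi_greedy_largest_coeffs scaleF e e' Suc C"

end

theory Submission
  imports Defs
begin

text \<open>
  Let \<open>A\<close> have \<open>m > 0\<close> elements and let \<open>y = 1\<^sub>\<epsilon>\<^sub>A + x\<close> be as in the definition of
  quasi-greediness for largest coefficients. Write \<open>n\<^sub>1 < n\<^sub>2 < \<dots>\<close> for the given sequence,
  whose first term is \<open>n 0\<close> in the code.

  If \<open>m < n\<^sub>1\<close>, then the sequence says nothing about \<open>A\<close>, and the trivial estimate is used: the
  triangle inequality gives \<open>\<parallel>1\<^sub>\<epsilon>\<^sub>A\<parallel> \<le> m \<alpha>\<^sub>1\<close>, while every coefficient of \<open>y\<close> on \<open>A\<close> has
  modulus \<open>1\<close>, so that \<open>1 \<le> \<alpha>\<^sub>2 \<parallel>y\<parallel>\<close> (\<open>norm_one_vec_le_card\<close>).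

  Otherwise let \<open>n\<^sub>k\<close> be the last term with \<open>n\<^sub>k \<le> m\<close>. For every \<open>B \<subseteq> A\<close> with \<open>n\<^sub>k\<close> elements,
  the part of \<open>y\<close> outside \<open>B\<close>, namely \<open>1\<^sub>\<epsilon>\<^sub>(\<^sub>A\<^sub>-\<^sub>B\<^sub>) + x\<close>, still has coefficients of modulus at
  most \<open>1\<close>; hence \<open>\<parallel>1\<^sub>\<epsilon>\<^sub>B\<parallel> \<le> C\<^sub>q\<^sub>l \<parallel>y\<parallel>\<close> (\<open>qglc_bound_subset\<close>). Since \<open>1\<^sub>\<epsilon>\<^sub>A\<close> is
  \<open>m / n\<^sub>k\<close> times the average of these \<open>1\<^sub>\<epsilon>\<^sub>B\<close> (\<open>norm_sum_le_of_card_subsets\<close>) and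
  \<open>m < n\<^sub>k\<^sub>+\<^sub>1 \<le> l n\<^sub>k\<close>, the constant \<open>l C\<^sub>q\<^sub>l\<close> works. A partition of \<open>A\<close> into blocks of \<open>n\<^sub>k\<close>
  elements would not do: the last block may have a cardinality outside the sequence.

  The admissible constants form a closed set bounded below by \<open>1\<close>, so the existence of one
  gives the smallest one (\<open>ex_least_qglc_constant\<close>).
\<close>

section \<open>Averages over subsets of fixed cardinality\<close>

text \<open>
  The whole sum is \<open>card A / k\<close> times the average of its subsums over \<open>k\<close>-subsets. The averaging
  is done by removing one point at a time: \<open>(card A - 1) \<Sum>A\<close> is the sum of the
  \<open>\<Sum>(A - {a})\<close> over \<open>a \<in> A\<close>, so no binomial coefficients have to be counted.
\<close>
lemma norm_sum_le_of_card_subsets: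
  fixes f :: "'a \<Rightarrow> 'b::real_normed_vector"
  assumes "finite A" "0 < k" "k \<le> card A"
    and "\<And>B. B \<subseteq> A \<Longrightarrow> card B = k \<Longrightarrow> norm (sum f B) \<le> M"
  shows "real k * norm (sum f A) \<le> real (card A) * M"
  using assms
proof (induction "card A" arbitrary: A rule: less_induct)
  case less
  show ?case
  proof (cases "k = card A")
    case True
    then show ?thesis using less.prems by (simp add: mult_left_mono)
  next
    case False
    then have k_lt: "k < card A" using less.prems by simp
    define m where "m = real (card A)"
    have m: "m > 1" using k_lt less.prems(2) by (simp add: m_def)
    have remove: "real k * norm (sum f (A - {a})) \<le> (m - 1) * M" if a: "a \<in> A" for a
    proof -
      have c: "card (A - {a}) = card A - 1" using a by simp
      have "real k * norm (sum f (A - {a})) \<le> real (card (A - {a})) * M"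
        using less.prems k_lt c by (intro less.hyps) auto
      moreover have "real (card (A - {a})) = m - 1"
        using c k_lt by (simp add: m_def of_nat_diff)
      ultimately show ?thesis by simp
    qed
    have "(\<Sum>a\<in>A. sum f (A - {a})) = (\<Sum>a\<in>A. sum f A - f a)"
      using less.prems(1) by (intro sum.cong) (auto simp: sum_diff1)
    also have "\<dots> = (m - 1) *\<^sub>R sum f A"
      by (simp add: sum_subtractf m_def scaleR_left_diff_distrib sum_constant_scaleR)
    finally have "(m - 1) * norm (sum f A) = norm (\<Sum>a\<in>A. sum f (A - {a}))"
      using m by simp
    also have "\<dots> \<le> (\<Sum>a\<in>A. norm (sum f (A - {a})))" by (rule norm_sum)
    finally have "real k * ((m - 1) * norm (sum f A)) \<le> (\<Sum>a\<in>A. real k * norm (sum f (A - {a})))"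
      unfolding sum_distrib_left[symmetric] by (rule mult_left_mono) simp
    also have "\<dots> \<le> (\<Sum>a\<in>A. (m - 1) * M)" by (intro sum_mono remove)
    also have "\<dots> = (m - 1) * (m * M)" by (simp add: m_def)
    finally have "(m - 1) * (real k * norm (sum f A)) \<le> (m - 1) * (m * M)"
      by (simp add: mult.left_commute)
    then show ?thesis using m by (simp add: m_def)
  qed
qed

lemma ex_last_le_strict_mono:
  fixes n :: "nat \<Rightarrow> nat"
  assumes "strict_mono n" "n 0 \<le> m"
  obtains k where "n k \<le> m" "m < n (Suc k)"
proof -
  have "m < n (Suc m)"
    using strict_mono_imp_increasing[OF assms(1), of "Suc m"] by simp
  then have "\<exists>j. m < n j" ..
  then obtain j where j: "m < n j" "\<And>i. i < j \<Longrightarrow> \<not> m < n i"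
    using exists_least_iff[of "\<lambda>j. m < n j"] by blast
  have "n (j - 1) \<le> m" "m < n (Suc (j - 1))"
    using j(1) j(2)[of "j - 1"] assms(2) by (cases j; simp)+
  then show ?thesis by (rule that)
qed

section \<open>Norm estimates for a basis\<close>

lemma qglc_boundD:
  assumes "qglc_bound scaleF e e' n C" "finite A" "card A \<in> range n" "\<epsilon> \<in> signs A"
    and "supp e' x \<inter> A = {}" "\<forall>i. norm (e' i x) \<le> 1"
  shows "norm (one_vec scaleF e \<epsilon> A) \<le> C * norm (one_vec scaleF e \<epsilon> A + x)"
  using assms unfolding qglc_bound_def by blast

context banach_basis
begin

lemma bounded_linear_coeff: "bounded_linear (e' i)"
  using dual[of i] by (simp add: dual_space_def)

lemma coeff_one_vec:
  assumes "finite A"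
  shows "e' i (one_vec scaleF e \<epsilon> A) = (if i \<in> A then \<epsilon> i else 0)"
proof -
  have "e' i (one_vec scaleF e \<epsilon> A) = (\<Sum>j\<in>A. \<epsilon> j * e' i (e j))"
    using dual[of i] unfolding one_vec_def
    by (simp add: linear_sum[OF bounded_linear.linear[OF bounded_linear_coeff]] dual_space_def)
  also have "\<dots> = (\<Sum>j\<in>A. if j = i then \<epsilon> j else 0)"
    by (intro sum.cong) (auto simp: biorthogonal)
  finally show ?thesis using assms by simp
qed

lemma norm_basis_le_alpha1: "norm (e i) \<le> alpha1 e"
proof -
  have "bdd_above (range (\<lambda>i. norm (e i)))"
    using sup_finite by (auto simp: bdd_above_def)
  then show ?thesis unfolding alpha1_def by (intro cSUP_upper) auto
qed

lemma onorm_coeff_le_alpha2: "onorm (e' i) \<le> alpha2 e'"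
proof -
  have "bdd_above (range (\<lambda>i. onorm (e' i)))"
    using sup_finite by (auto simp: bdd_above_def)
  then show ?thesis unfolding alpha2_def by (intro cSUP_upper) auto
qed

lemma norm_coeff_le_alpha2: "norm (e' i y) \<le> alpha2 e' * norm y"
proof -
  have "onorm (e' i) * norm y \<le> alpha2 e' * norm y"
    using onorm_coeff_le_alpha2 by (simp add: mult_right_mono)
  with onorm[OF bounded_linear_coeff, of i y] show ?thesis by simp
qed

lemma alpha1_nonneg: "0 \<le> alpha1 e"
  using norm_basis_le_alpha1[of 0] norm_ge_zero order_trans by blast

lemma alpha2_nonneg: "0 \<le> alpha2 e'"
  using onorm_pos_le[OF bounded_linear_coeff] onorm_coeff_le_alpha2[of 0] order_trans by blast

text \<open>
  This holds for every basis: a single coefficient on \<open>A\<close> already bounds the norm of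
  \<open>1\<^sub>\<epsilon>\<^sub>A + x\<close> away from \<open>0\<close>. The constant grows with \<open>card A\<close>, so it serves only for the sets
  with fewer than \<open>n 0\<close> elements.
\<close>
lemma norm_one_vec_le_card:
  assumes A: "finite A" "A \<noteq> {}" and \<epsilon>: "\<epsilon> \<in> signs A" and disj: "supp e' x \<inter> A = {}"
  shows "norm (one_vec scaleF e \<epsilon> A)
    \<le> real (card A) * alpha1 e * alpha2 e' * norm (one_vec scaleF e \<epsilon> A + x)"
proof -
  let ?y = "one_vec scaleF e \<epsilon> A + x"
  obtain i where i: "i \<in> A" using A by blast
  then have "e' i ?y = \<epsilon> i"
    using disj A by (auto simp: linear_add[OF bounded_linear.linear[OF bounded_linear_coeff]]
      coeff_one_vec supp_def)
  then have one: "1 \<le> alpha2 e' * norm ?y"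
    using norm_coeff_le_alpha2[of i ?y] \<epsilon> i by (simp add: signs_def)
  have "norm (one_vec scaleF e \<epsilon> A) \<le> (\<Sum>i\<in>A. alpha1 e)"
    unfolding one_vec_def
    using \<epsilon> norm_basis_le_alpha1 by (intro sum_norm_le) (simp add: norm_scale signs_def)
  also have "\<dots> = real (card A) * alpha1 e * 1" by simp
  also have "\<dots> \<le> real (card A) * alpha1 e * (alpha2 e' * norm ?y)"
    using one alpha1_nonneg by (intro mult_left_mono) auto
  finally show ?thesis by (simp add: mult.assoc)
qed

text \<open>
  The part of \<open>1\<^sub>\<epsilon>\<^sub>A\<close> outside \<open>B\<close> can be absorbed into \<open>x\<close>, because its coefficients have modulus
  exactly \<open>1\<close>. So the estimate for \<open>B\<close> has the same right-hand side for all \<open>B \<subseteq> A\<close>.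
\<close>
lemma qglc_bound_subset:
  assumes bound: "qglc_bound scaleF e e' n C"
    and A: "finite A" and B: "B \<subseteq> A" "card B \<in> range n"
    and \<epsilon>: "\<epsilon> \<in> signs A" and disj: "supp e' x \<inter> A = {}" and le1: "\<forall>i. norm (e' i x) \<le> 1"
  shows "norm (one_vec scaleF e \<epsilon> B) \<le> C * norm (one_vec scaleF e \<epsilon> A + x)"
proof -
  define x' where "x' = one_vec scaleF e \<epsilon> (A - B) + x"
  have coeff: "e' i x' = (if i \<in> A - B then \<epsilon> i else e' i x)" for i
    using A disj by (auto simp: x'_def coeff_one_vec supp_def
      linear_add[OF bounded_linear.linear[OF bounded_linear_coeff]])
  have "supp e' x' \<inter> B = {}" using disj B by (auto simp: supp_def coeff)
  moreover have "\<forall>i. norm (e' i x') \<le> 1" using le1 \<epsilon> by (auto simp: coeff signs_def)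
  moreover have "\<epsilon> \<in> signs B" "finite B" using \<epsilon> A B by (auto simp: signs_def finite_subset)
  ultimately have "norm (one_vec scaleF e \<epsilon> B) \<le> C * norm (one_vec scaleF e \<epsilon> B + x')"
    using bound B by (intro qglc_boundD)
  moreover have "one_vec scaleF e \<epsilon> B + x' = one_vec scaleF e \<epsilon> A + x"
    using sum.subset_diff[OF B(1) A, of "\<lambda>i. \<epsilon> i *\<^sub>F e i"]
    by (simp add: x'_def one_vec_def algebra_simps)
  ultimately show ?thesis by simp
qed

lemma norm_one_vec_le_quotient:
  assumes bound: "qglc_bound scaleF e e' n C" and k: "0 < n k" "n k \<le> card A"
    and A: "finite A" and \<epsilon>: "\<epsilon> \<in> signs A" and disj: "supp e' x \<inter> A = {}"
    and le1: "\<forall>i. norm (e' i x) \<le> 1"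
  shows "norm (one_vec scaleF e \<epsilon> A)
    \<le> real (card A) / real (n k) * C * norm (one_vec scaleF e \<epsilon> A + x)"
proof -
  have "real (n k) * norm (\<Sum>i\<in>A. \<epsilon> i *\<^sub>F e i)
      \<le> real (card A) * (C * norm (one_vec scaleF e \<epsilon> A + x))"
    using qglc_bound_subset[OF bound A _ _ \<epsilon> disj le1]
    by (intro norm_sum_le_of_card_subsets A k) (auto simp: one_vec_def)
  then show ?thesis using k(1) by (simp add: one_vec_def[of _ _ _ A] field_simps)
qed

lemma qglc_bound_all_cardinalities:
  assumes seq: "pos_int_seq n" and gaps: "bounded_quotient_gaps l n"
    and bound: "qglc_bound scaleF e e' n C" and l: "0 < l"
  shows "qglc_bound scaleF e e' Suc
    (max ((real (n 0) - 1) * alpha1 e * alpha2 e') (real l * C))"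
    (is "qglc_bound _ _ _ _ ?K")
proof -
  have C: "0 < C" using bound by (simp add: qglc_bound_def)
  have "norm (one_vec scaleF e \<epsilon> A) \<le> ?K * norm (one_vec scaleF e \<epsilon> A + x)"
    if A: "finite A" "card A \<in> range Suc" and \<epsilon>: "\<epsilon> \<in> signs A"
      and disj: "supp e' x \<inter> A = {}" and le1: "\<forall>i. norm (e' i x) \<le> 1" for A \<epsilon> x
  proof -
    have "\<exists>D \<le> ?K. norm (one_vec scaleF e \<epsilon> A) \<le> D * norm (one_vec scaleF e \<epsilon> A + x)"
    proof (cases "n 0 \<le> card A")
      case True
      with seq obtain k where k: "n k \<le> card A" "card A < n (Suc k)"
        by (auto simp: pos_int_seq_def elim: ex_last_le_strict_mono)
      have nk: "0 < n k" using seq by (simp add: pos_int_seq_def)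
      have "real (card A) / real (n k) \<le> real (n (Suc k)) / real (n k)"
        using k by (intro divide_right_mono) auto
      also have "\<dots> \<le> real l" using gaps by (simp add: bounded_quotient_gaps_def)
      finally have "real (card A) / real (n k) * C \<le> ?K"
        using C by (intro order_trans[OF mult_right_mono max.cobounded2]) auto
      with norm_one_vec_le_quotient[OF bound nk k(1) A(1) \<epsilon> disj le1] show ?thesis by blast
    next
      case False
      then have "real (card A) \<le> real (n 0) - 1" by linarith
      then have "real (card A) * alpha1 e * alpha2 e' \<le> ?K"
        by (intro order_trans[OF mult_right_mono[OF mult_right_mono] max.cobounded1]
          alpha1_nonneg alpha2_nonneg)
      moreover have "A \<noteq> {}" using A by auto
      ultimately show ?thesis using norm_one_vec_le_card[OF A(1) _ \<epsilon> disj] by blast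
    qed
    then show ?thesis by (meson mult_right_mono norm_ge_zero order_trans)
  qed
  moreover have "0 < ?K" using C l by (simp add: less_max_iff_disj)
  ultimately show ?thesis unfolding qglc_bound_def by blast
qed

section \<open>The least admissible constant\<close>

text \<open>
  A least admissible constant exists because the defining inequalities are closed in \<open>C\<close>. The
  condition \<open>C > 0\<close> is not closed, but a singleton \<open>A\<close> with \<open>x = 0\<close> forces \<open>C \<ge> 1\<close>.
\<close>
lemma ex_least_qglc_constant:
  assumes bound: "qglc_bound scaleF e e' Suc K"
  shows "\<exists>C \<le> K. quasi_greedy_largest_coeffs scaleF e e' C"
proof -
  let ?S = "{C. qglc_bound scaleF e e' Suc C}"
  have ge1: "1 \<le> C" if "C \<in> ?S" for C
  proof -
    have "card {0::nat} \<in> range Suc" "(\<lambda>_. 1 :: 'f) \<in> signs {0}"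
      "supp e' 0 \<inter> {0} = {}" "\<forall>i. norm (e' i 0) \<le> 1"
      using linear_0[OF bounded_linear.linear[OF bounded_linear_coeff]]
      by (auto simp: signs_def supp_def)
    then have "norm (one_vec scaleF e (\<lambda>_. 1) {0}) \<le> C * norm (one_vec scaleF e (\<lambda>_. 1) {0} + 0)"
      using that by (intro qglc_boundD) auto
    then have "norm (e 0) \<le> C * norm (e 0)" by (simp add: one_vec_def)
    moreover have "e 0 \<noteq> 0"
      using biorthogonal[of 0 0] linear_0[OF bounded_linear.linear[OF bounded_linear_coeff], of 0]
      by auto
    ultimately show ?thesis by simp
  qed
  have ne: "?S \<noteq> {}" using bound by blast
  have bdd: "bdd_below ?S" using ge1 by (intro bdd_belowI)
  have "1 \<le> Inf ?S" using ne ge1 by (rule cInf_greatest)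
  moreover have "norm (one_vec scaleF e \<epsilon> A) \<le> Inf ?S * norm (one_vec scaleF e \<epsilon> A + x)"
    if H: "finite A" "card A \<in> range Suc" "\<epsilon> \<in> signs A"
      "supp e' x \<inter> A = {}" "\<forall>i. norm (e' i x) \<le> 1" for A \<epsilon> x
  proof (cases "one_vec scaleF e \<epsilon> A + x = 0")
    case True
    then show ?thesis using qglc_boundD[OF bound H] by simp
  next
    case False
    have "norm (one_vec scaleF e \<epsilon> A) / norm (one_vec scaleF e \<epsilon> A + x) \<le> Inf ?S"
    proof (rule cInf_greatest[OF ne])
      fix C assume "C \<in> ?S"
      then have "norm (one_vec scaleF e \<epsilon> A) \<le> C * norm (one_vec scaleF e \<epsilon> A + x)"
        using H by (intro qglc_boundD) auto
      then show "norm (one_vec scaleF e \<epsilon> A) / norm (one_vec scaleF e \<epsilon> A + x) \<le> C"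
        using False by (simp add: divide_le_eq)
    qed
    then show ?thesis using False by (simp add: divide_le_eq)
  qed
  ultimately have "qglc_bound scaleF e e' Suc (Inf ?S)" unfolding qglc_bound_def by auto
  moreover have least: "Inf ?S \<le> C" if "qglc_bound scaleF e e' Suc C" for C
    using that bdd by (intro cInf_lower) auto
  ultimately have "quasi_greedy_largest_coeffs scaleF e e' (Inf ?S)"
    unfolding quasi_greedy_largest_coeffs_def n_quasi_greedy_largest_coeffs_def by blast
  with least[OF bound] show ?thesis by blast
qed

end

theorem proposition4p3:
  fixes scaleF :: "'f::real_normed_field \<Rightarrow> 'x::banach \<Rightarrow> 'x"
    and e :: "nat \<Rightarrow> 'x" and e' :: "nat \<Rightarrow> 'x \<Rightarrow> 'f"
    and n :: "nat \<Rightarrow> nat" and l :: nat and C_ql :: real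
  assumes "banach_basis scaleF e e'"
    and "pos_int_seq n"
    and "l \<ge> 2"
    and "bounded_quotient_gaps l n"
    and "n_quasi_greedy_largest_coeffs scaleF e e' n C_ql"
  shows "\<exists>C. quasi_greedy_largest_coeffs scaleF e e' C \<and>
    C \<le> max ((real (n 0) - 1) * alpha1 e * alpha2 e') (real l * C_ql)"
proof -
  interpret banach_basis scaleF e e' by fact
  have "qglc_bound scaleF e e' n C_ql"
    using assms(5) by (simp add: n_quasi_greedy_largest_coeffs_def)
  then have "qglc_bound scaleF e e' Suc
      (max ((real (n 0) - 1) * alpha1 e * alpha2 e') (real l * C_ql))"
    using assms(2-4) by (intro qglc_bound_all_cardinalities) auto
  then show ?thesis using ex_least_qglc_constant by blast
qed

end
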